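(* Let $\mathcal F$ be either the function space $\mathcal F_\Phi$ associated with a complex equiangular tight frame $\Phi$ of $N$ vectors in $\mathbb C^m$, $m\ge2$ (the "ETF space"), or the complete-graph space $\mathcal F_{\mathcal K}$ on $|V|=m+1\ge3$ vertices, in which case $N=m(m+1)/2$ (the "graph space"); in both cases $m=\dim\mathcal F$. Fix $m\le n\le N/2$ distinct points and positive weights for which the normal matrix $\boldsymbol M$ is positive definite. Then $$\varepsilon_\star(\boldsymbol M)^2\ge\frac{N-n}{N+\beta n}\quad\text{with}\quad\beta=\begin{cases}\dfrac{N-m}{m-1}&\text{for the ETF space},\\ m&\text{for the graph space}.\end{cases}$$ Furthermore, for every $0<\delta<1$, $$n_{\rm iter}(\boldsymbol M)\ge\left\lceil\frac{2\log(\delta/2)}{\log(m/(24n))}\right\rceil.$$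
   Context: ETF space: an equiangular tight frame for $\mathbb C^m$ is a family $\Phi=\{\boldsymbol\varphi_1,\dots,\boldsymbol\varphi_N\}\subset\mathbb C^m$ of unit vectors such that $|\langle\boldsymbol\varphi_i,\boldsymbol\varphi_j\rangle|$ is the same constant for all $i\ne j$ and $\sum_{i=1}^N|\langle\boldsymbol a,\boldsymbol\varphi_i\rangle|^2=\frac Nm\|\boldsymbol a\|_2^2$ for all $\boldsymbol a\in\mathbb C^m$. On $\Omega=\{1,\dots,N\}$ with counting measure, $\mathcal F_\Phi=\{f_{\boldsymbol a}:\Omega\to\mathbb C,\ f_{\boldsymbol a}(i)=\sqrt{m/N}\,\langle\boldsymbol a,\boldsymbol\varphi_i\rangle:\boldsymbol a\in\mathbb C^m\}$. Graph space: $V$ is a finite set with $|V|=m+1$, $\Omega=\binom V2$ (the two-element subsets of $V$, with $N=|\Omega|=m(m+1)/2$) carries the counting measure, and, with an arbitrary fixed ordering of the endpoints of each edge, $\mathcal F_{\mathcal K}=\{f_{\boldsymbol a}:\Omega\to\mathbb R,\ f_{\boldsymbol a}(\{u,v\})=(a_u-a_v)/\sqrt{|V|}:\boldsymbol a\in\mathbb R^{|V|},\ \sum_{u\in V}a_u=0\}$. Normal matrix: given an orthonormal basis $\eta_1,\dots,\eta_m$ of $\mathcal F\subseteq L_2(\Omega)$, distinct points $x_1,\dots,x_n\in\Omega$ and weights $w_1,\dots,w_n>0$, let $\boldsymbol\eta(x)=[\eta_1(x),\dots,\eta_m(x)]^\ast$ (conjugate-transposed row, a column vector) and $\boldsymbol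 M=\sum_{i=1}^nw_i\boldsymbol\eta(x_i)\boldsymbol\eta(x_i)^\ast\in\mathbb C^{m\times m}$. For positive definite $\boldsymbol M$ let $\kappa(\boldsymbol M)=\lambda_{\max}(\boldsymbol M)/\lambda_{\min}(\boldsymbol M)$, $$\varepsilon_\star(\boldsymbol M)=\inf_{c>0}\|c\boldsymbol M-\boldsymbol I_m\|_2=\frac{\kappa(\boldsymbol M)-1}{\kappa(\boldsymbol M)+1},\qquad q(\boldsymbol M)=\frac{\sqrt{\kappa(\boldsymbol M)}-1}{\sqrt{\kappa(\boldsymbol M)}+1}.$$ For $0<\delta<1$, the certified iteration count is $n_{\rm iter}(\boldsymbol M)=\min\{i\in\mathbb N_0:2q(\boldsymbol M)^i\le\delta\}$ (with $0^0=1$). *)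

theory Defs
  imports "HOL-Analysis.Analysis"
begin

text \<open>
  The dimension $m$ is \<^term>\<open>CARD('m)\<close>, where the finite index type \<^typ>\<open>'m\<close> labels the
  coordinates of $C^m$ as well as the members of an orthonormal basis of the function space.
\<close>

definition cinner_vec :: "complex^'m \<Rightarrow> complex^'m \<Rightarrow> complex" where
  "cinner_vec a b = (\<Sum>j\<in>UNIV. a $ j * cnj (b $ j))"

definition equiangular_tight_frame :: "nat \<Rightarrow> (nat \<Rightarrow> complex^'m) \<Rightarrow> bool" where
  "equiangular_tight_frame N \<phi> \<longleftrightarrow>
     (\<forall>i\<in>{1..N}. norm (\<phi> i) = 1) \<and>
     (\<exists>\<mu>. \<forall>i\<in>{1..N}. \<forall>j\<in>{1..N}. i \<noteq> j \<longrightarrow> cmod (cinner_vec (\<phi> i) (\<phi> j)) = \<mu>) \<and>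
     (\<forall>a. (\<Sum>i=1..N. (cmod (cinner_vec a (\<phi> i)))\<^sup>2) = real N / real CARD('m) * (norm a)\<^sup>2)"

text \<open>
  Functions on a set \<open>\<Omega>\<close> are represented extensionally, by \<^const>\<open>restrict\<close>.
\<close>

definition etf_space :: "nat \<Rightarrow> (nat \<Rightarrow> complex^'m) \<Rightarrow> (nat \<Rightarrow> complex) set" where
  "etf_space N \<phi> =
     {(\<lambda>i\<in>{1..N}. complex_of_real (sqrt (real CARD('m) / real N)) * cinner_vec a (\<phi> i)) | a. True}"

definition edges :: "'v set \<Rightarrow> 'v set set" where
  "edges V = {e. e \<subseteq> V \<and> card e = 2}"

definition edge_ordering :: "'v set \<Rightarrow> ('v set \<Rightarrow> 'v) \<Rightarrow> ('v set \<Rightarrow> 'v) \<Rightarrow> bool" where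
  "edge_ordering V src tgt \<longleftrightarrow> (\<forall>e\<in>edges V. e = {src e, tgt e})"

text \<open>
  The graph space is a real vector space of real-valued functions; the values are embedded into
  the complex numbers so that both spaces have the same type.
\<close>

definition graph_space ::
    "'v set \<Rightarrow> ('v set \<Rightarrow> 'v) \<Rightarrow> ('v set \<Rightarrow> 'v) \<Rightarrow> ('v set \<Rightarrow> complex) set" where
  "graph_space V src tgt =
     {(\<lambda>e\<in>edges V. complex_of_real ((a (src e) - a (tgt e)) / sqrt (real (card V))))
        | a :: 'v \<Rightarrow> real. (\<Sum>u\<in>V. a u) = 0}"

text \<open>
  Orthonormality is in $L_2(\Omega)$ with counting measure. The scalars are \<open>K = UNIV\<close> for a
  complex space and \<open>K = \<real>\<close> for a real one.
\<close>

definition orthonormal_basis ::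
    "complex set \<Rightarrow> 'x set \<Rightarrow> ('x \<Rightarrow> complex) set \<Rightarrow> ('m::finite \<Rightarrow> 'x \<Rightarrow> complex) \<Rightarrow> bool" where
  "orthonormal_basis K \<Omega> F \<eta> \<longleftrightarrow>
     (\<forall>j. \<eta> j \<in> F) \<and>
     (\<forall>j k. (\<Sum>x\<in>\<Omega>. \<eta> j x * cnj (\<eta> k x)) = (if j = k then 1 else 0)) \<and>
     F = {(\<lambda>x\<in>\<Omega>. \<Sum>j\<in>UNIV. c j * \<eta> j x) | c. \<forall>j. c j \<in> K}"

definition eta_vec :: "('m::finite \<Rightarrow> 'x \<Rightarrow> complex) \<Rightarrow> 'x \<Rightarrow> complex^'m" where
  "eta_vec \<eta> x = (\<chi> j. cnj (\<eta> j x))"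

definition normal_matrix ::
    "('m::finite \<Rightarrow> 'x \<Rightarrow> complex) \<Rightarrow> nat \<Rightarrow> (nat \<Rightarrow> 'x) \<Rightarrow> (nat \<Rightarrow> real) \<Rightarrow> complex^'m^'m" where
  "normal_matrix \<eta> n x w =
     (\<Sum>i=1..n. w i *\<^sub>R (\<chi> j k. eta_vec \<eta> (x i) $ j * cnj (eta_vec \<eta> (x i) $ k)))"

definition positive_definite :: "complex^'m^'m \<Rightarrow> bool" where
  "positive_definite A \<longleftrightarrow>
     (\<forall>j k. A $ j $ k = cnj (A $ k $ j)) \<and> (\<forall>v. v \<noteq> 0 \<longrightarrow> 0 < Re (cinner_vec (A *v v) v))"

text \<open>
  Only real eigenvalues are collected; for Hermitian matrices these are all of them.
\<close>

definition real_eigenvalues :: "complex^'m^'m \<Rightarrow> real set" where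
  "real_eigenvalues A = {l. \<exists>v. v \<noteq> 0 \<and> A *v v = complex_of_real l *s v}"

definition lambda_max :: "complex^'m^'m \<Rightarrow> real" where
  "lambda_max A = Max (real_eigenvalues A)"

definition lambda_min :: "complex^'m^'m \<Rightarrow> real" where
  "lambda_min A = Min (real_eigenvalues A)"

definition kappa :: "complex^'m^'m \<Rightarrow> real" where
  "kappa A = lambda_max A / lambda_min A"

definition spectral_norm :: "complex^'m^'m \<Rightarrow> real" where
  "spectral_norm A = onorm (\<lambda>v. A *v v)"

definition eps_star :: "complex^'m^'m \<Rightarrow> real" where
  "eps_star A = (INF c\<in>{0<..}. spectral_norm (c *\<^sub>R A - mat 1))"

definition q_rate :: "complex^'m^'m \<Rightarrow> real" where
  "q_rate A = (sqrt (kappa A) - 1) / (sqrt (kappa A) + 1)"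

definition n_iter :: "complex^'m^'m \<Rightarrow> real \<Rightarrow> nat" where
  "n_iter A \<delta> = (LEAST i. 2 * q_rate A ^ i \<le> \<delta>)"

end

theory Submission
  imports Defs
begin

text \<open>
  Let $T$ and $F$ be the trace and the squared Frobenius norm of the normal matrix $M$.
  For every $c > 0$,
  $$\|cM - I\|_2^2 \ge \frac1m \|cM-I\|_F^2 = \frac1m(c^2 F - 2cT + m) \ge 1 - \frac{T^2}{mF},$$
  so a lower bound on $F$ in terms of $T$ bounds $\varepsilon_\star(M)$ from below
  (\<open>eps_star_ge\<close>). In terms of the reproducing kernel $K$ of the function space,
  $T = \sum_i w_i K(x_i,x_i)$ and $F = \sum_{i,j} w_i w_j |K(x_i,x_j)|^2$, and $K$ is explicit in
  both spaces. For the ETF space, $K(x,x) = m/N$ and $|K(x,y)|$ is constant off the diagonal, with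
  the constant fixed by the tightness of the frame; for the graph space, $K(e,f)$ is up to the
  factor $1/|V|$ the inner product of the signed incidence vectors of $e$ and $f$, so that
  $|V|^2 K(e,f)^2 = |e\cap f| + 2[e=f]$. In both cases the Cauchy--Schwarz inequality gives
  $T^2 \le m(1-\varrho)F$ with $\varrho = (N-n)/(N+\beta n)$.

  For the iteration count, $c = 2/(\lambda_{\max}+\lambda_{\min})$ shows
  $\varepsilon_\star \le (\kappa-1)/(\kappa+1) = 2q/(1+q^2) \le 2q$
  (\<open>eps_star_le_kappa\<close>), hence $q^2 \ge \varrho/4 \ge m/(24n)$, and taking logarithms in
  $q^i \le \delta/2$ finishes the proof. The extreme eigenvalues are reached without a spectral
  theorem: complex vectors are regarded as a real Euclidean space with inner product
  $\mathrm{Re}\langle a,b\rangle$, and the Rayleigh quotient of a self-adjoint map attains its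
  extrema on the unit sphere at eigenvectors.
\<close>

section \<open>Self-adjoint maps on a Euclidean space\<close>

lemma selfadjoint_quadratic_form_add:
  fixes T :: "'a::euclidean_space \<Rightarrow> 'a"
  assumes "linear T" and "\<And>x y. T x \<bullet> y = x \<bullet> T y"
  shows "T (x + y) \<bullet> (x + y) = T x \<bullet> x + 2 * (T x \<bullet> y) + T y \<bullet> y"
proof -
  have "T y \<bullet> x = T x \<bullet> y"
    using assms(2)[of y x] by (simp add: inner_commute)
  then show ?thesis
    by (simp add: linear_add[OF assms(1)] inner_add_left inner_add_right)
qed

lemma selfadjoint_greatest_eigenvalue:
  fixes T :: "'a::euclidean_space \<Rightarrow> 'a"
  assumes lin: "linear T" and sa: "\<And>x y. T x \<bullet> y = x \<bullet> T y"
  obtains l v where "v \<noteq> 0" "T v = l *\<^sub>R v" "\<And>x. T x \<bullet> x \<le> l * (x \<bullet> x)"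
proof -
  have "continuous_on (sphere 0 1) (\<lambda>x. T x \<bullet> x)"
    by (intro continuous_intros linear_continuous_on linear_conv_bounded_linear[THEN iffD1] lin)
  moreover have "sphere (0::'a) 1 \<noteq> {}" by simp
  ultimately have "\<exists>v\<in>sphere 0 1. \<forall>y\<in>sphere 0 1. T y \<bullet> y \<le> T v \<bullet> v"
    by (intro continuous_attains_sup compact_sphere)
  then obtain v where v: "norm v = 1" and vmax: "\<And>y. norm y = 1 \<Longrightarrow> T y \<bullet> y \<le> T v \<bullet> v"
    by auto
  define l where "l = T v \<bullet> v"
  have le: "T x \<bullet> x \<le> l * (x \<bullet> x)" for x
  proof (cases "x = 0")
    case False
    have "T (inverse (norm x) *\<^sub>R x) \<bullet> (inverse (norm x) *\<^sub>R x) \<le> l"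
      unfolding l_def by (rule vmax) (use False in simp)
    then have "(T x \<bullet> x) / (norm x)\<^sup>2 \<le> l"
      by (simp add: linear_cmul[OF lin] divide_inverse power2_eq_square mult_ac)
    then show ?thesis
      using False by (simp add: divide_le_eq power2_norm_eq_inner)
  qed (simp add: linear_0[OF lin])
  define r where "r = T v - l *\<^sub>R v"
  define C where "C = l * (r \<bullet> r) - T r \<bullet> r"
  have C: "C \<ge> 0" using le[of r] by (simp add: C_def)
  have vv: "v \<bullet> v = 1" using v by (simp add: norm_eq_1)
  \<comment> \<open>Optimality optimality of \<open>v\<close> in the direction of the residual \<open>r\<close>.\<close>
  have opt: "2 * t * (r \<bullet> r) \<le> t\<^sup>2 * C" for t
  proof -
    have "T (v + t *\<^sub>R r) \<bullet> (v + t *\<^sub>R r) = l + 2 * t * (T v \<bullet> r) + t\<^sup>2 * (T r \<bullet> r)"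
      unfolding selfadjoint_quadratic_form_add[OF lin sa]
      by (simp add: linear_cmul[OF lin] l_def power2_eq_square)
    moreover have "(v + t *\<^sub>R r) \<bullet> (v + t *\<^sub>R r) = 1 + 2 * t * (v \<bullet> r) + t\<^sup>2 * (r \<bullet> r)"
      by (simp add: inner_add_left inner_add_right vv inner_commute power2_eq_square)
    moreover have "T v \<bullet> r = r \<bullet> r + l * (v \<bullet> r)"
      by (simp add: r_def inner_diff_left)
    ultimately show ?thesis
      using le[of "v + t *\<^sub>R r"] by (simp add: C_def algebra_simps)
  qed
  have "r \<bullet> r = 0"
  proof (rule ccontr)
    assume "r \<bullet> r \<noteq> 0"
    then have rr: "r \<bullet> r > 0" by simp
    define t where "t = (r \<bullet> r) / (C + 1)"
    have t: "t > 0" "t * C < r \<bullet> r"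
      using rr C by (auto simp: t_def field_simps)
    have "t * (2 * (r \<bullet> r)) \<le> t * (t * C)"
      using opt[of t] by (simp add: power2_eq_square mult_ac)
    then have "2 * (r \<bullet> r) \<le> t * C" using t(1) by simp
    then show False using t(2) rr by linarith
  qed
  then have "T v = l *\<^sub>R v" by (simp add: r_def)
  with that le v show ?thesis by (metis norm_zero zero_neq_one)
qed

lemma selfadjoint_least_eigenvalue:
  fixes T :: "'a::euclidean_space \<Rightarrow> 'a"
  assumes lin: "linear T" and sa: "\<And>x y. T x \<bullet> y = x \<bullet> T y"
  obtains l v where "v \<noteq> 0" "T v = l *\<^sub>R v" "\<And>x. l * (x \<bullet> x) \<le> T x \<bullet> x"
proof -
  have "linear (\<lambda>x. - T x)" by (intro linear_compose_neg lin)
  then obtain l v where "v \<noteq> 0" "- T v = l *\<^sub>R v" "\<And>x. - T x \<bullet> x \<le> l * (x \<bullet> x)"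
    by (rule selfadjoint_greatest_eigenvalue) (auto simp: sa)
  then show ?thesis
    by (intro that[of v "- l"]) (simp_all add: minus_equation_iff[of "T v"] minus_le_iff)
qed

lemma selfadjoint_norm_le:
  fixes T :: "'a::euclidean_space \<Rightarrow> 'a"
  assumes lin: "linear T" and sa: "\<And>x y. T x \<bullet> y = x \<bullet> T y"
    and r: "\<And>x. \<bar>T x \<bullet> x\<bar> \<le> r * (x \<bullet> x)"
  shows "norm (T x) \<le> r * norm x"
proof (cases "x = 0 \<or> T x = 0")
  case True
  moreover have "r \<ge> 0" if "x \<noteq> 0"
  proof -
    have "0 \<le> r * (x \<bullet> x)" using r[of x] by linarith
    moreover have "x \<bullet> x > 0" using that by simp
    ultimately show ?thesis by (simp add: zero_le_mult_iff)
  qed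
  ultimately show ?thesis by (cases "x = 0") (auto simp: linear_0[OF lin])
next
  case False
  define y where "y = (norm x / norm (T x)) *\<^sub>R T x"
  have ny: "y \<bullet> y = x \<bullet> x"
    using False by (simp add: y_def dot_square_norm power2_eq_square)
  have Txy: "T x \<bullet> y = norm x * norm (T x)"
    using False by (simp add: y_def dot_square_norm power2_eq_square)
  \<comment> \<open>Polarization, with \<open>y\<close> the multiple of \<open>T x\<close> as long as \<open>x\<close>.\<close>
  have "4 * (T x \<bullet> y) = T (x + y) \<bullet> (x + y) - T (x + - y) \<bullet> (x + - y)"
    unfolding selfadjoint_quadratic_form_add[OF lin sa] by (simp add: linear_neg[OF lin])
  also have "\<dots> \<le> r * ((x + y) \<bullet> (x + y)) + r * ((x + - y) \<bullet> (x + - y))"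
    using r[of "x + y"] r[of "x + - y"] by linarith
  also have "\<dots> = 4 * r * (norm x)\<^sup>2"
    by (simp add: inner_add_left inner_add_right inner_diff_left inner_diff_right ny inner_commute
        algebra_simps flip: dot_square_norm)
  finally have "norm x * norm (T x) \<le> norm x * (r * norm x)"
    by (simp add: Txy power2_eq_square mult_ac)
  then show ?thesis using False by simp
qed

lemma selfadjoint_finite_eigenvalues:
  fixes T :: "'a::euclidean_space \<Rightarrow> 'a"
  assumes sa: "\<And>x y. T x \<bullet> y = x \<bullet> T y"
  shows "finite {l. \<exists>v. v \<noteq> 0 \<and> T v = l *\<^sub>R v}" (is "finite ?E")
proof -
  have "\<forall>l. \<exists>v. l \<in> ?E \<longrightarrow> v \<noteq> 0 \<and> T v = l *\<^sub>R v" by blast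
  from choice[OF this]
  obtain v where v: "\<And>l. l \<in> ?E \<Longrightarrow> v l \<noteq> 0 \<and> T (v l) = l *\<^sub>R v l"
    by blast
  have orth: "v k \<bullet> v l = 0" if "k \<in> ?E" "l \<in> ?E" "k \<noteq> l" for k l
  proof -
    have "k * (v k \<bullet> v l) = l * (v k \<bullet> v l)"
      using sa[of "v k" "v l"] v that by simp
    then show ?thesis using \<open>k \<noteq> l\<close> by simp
  qed
  have "inj_on v ?E"
  proof (rule inj_onI, rule ccontr)
    fix k l assume kl: "k \<in> ?E" "l \<in> ?E" "v k = v l" "k \<noteq> l"
    have "v k \<bullet> v l = 0" using kl(1,2,4) by (rule orth)
    then show False using v[OF kl(1)] kl(3) by simp
  qed
  moreover have "finite (v ` ?E)"
    using orth by (intro pairwise_orthogonal_imp_finite) (auto simp: pairwise_def orthogonal_def)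
  ultimately show ?thesis by (rule finite_imageD[rotated])
qed

section \<open>Hermitian matrices\<close>

lemma Re_cinner_vec: "Re (cinner_vec a b) = a \<bullet> b"
  by (simp add: cinner_vec_def inner_vec_def inner_complex_def)

lemma linear_matrix_vector_mult_complex:
  "linear (\<lambda>v. A *v v)" for A :: "complex^'m^'m"
  by (intro linearI)
     (simp_all add: vec_eq_iff matrix_vector_mult_def sum.distrib scaleR_sum_right algebra_simps)

lemma hermitian_selfadjoint:
  fixes A :: "complex^'m^'m"
  assumes "\<And>j k. A $ j $ k = cnj (A $ k $ j)"
  shows "(A *v x) \<bullet> y = x \<bullet> (A *v y)"
proof -
  have "cinner_vec (A *v x) y = (\<Sum>j\<in>UNIV. \<Sum>k\<in>UNIV. A $ j $ k * x $ k * cnj (y $ j))"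
    by (simp add: cinner_vec_def matrix_vector_mult_def sum_distrib_right)
  also have "\<dots> = (\<Sum>k\<in>UNIV. \<Sum>j\<in>UNIV. x $ k * cnj (A $ k $ j * y $ j))"
    by (subst sum.swap) (simp add: assms[symmetric] mult_ac)
  also have "\<dots> = cinner_vec x (A *v y)"
    by (simp add: cinner_vec_def matrix_vector_mult_def sum_distrib_left)
  finally show ?thesis by (metis Re_cinner_vec)
qed

lemma positive_definite_selfadjoint:
  assumes "positive_definite A"
  shows "(A *v x) \<bullet> y = x \<bullet> (A *v y)"
proof (rule hermitian_selfadjoint)
  have "\<forall>j k. A $ j $ k = cnj (A $ k $ j)"
    using assms unfolding positive_definite_def by (rule conjunct1)
  then show "A $ j $ k = cnj (A $ k $ j)" for j k by (elim allE)
qed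

lemma real_eigenvalues_eq:
  fixes A :: "complex^'m^'m"
  shows "real_eigenvalues A = {l. \<exists>v. v \<noteq> 0 \<and> A *v v = l *\<^sub>R v}"
proof -
  have "complex_of_real l *s v = l *\<^sub>R v" for l and v :: "complex^'m"
    unfolding vec_eq_iff by (simp add: scaleR_conv_of_real[where 'a = complex])
  then show ?thesis by (simp add: real_eigenvalues_def)
qed

lemma positive_definite_lambda:
  fixes A :: "complex^'m^'m"
  assumes "positive_definite A"
  shows "0 < lambda_min A" and "lambda_min A \<le> lambda_max A"
    and "lambda_min A * (v \<bullet> v) \<le> (A *v v) \<bullet> v" and "(A *v v) \<bullet> v \<le> lambda_max A * (v \<bullet> v)"
proof -
  have sa: "(A *v x) \<bullet> y = x \<bullet> (A *v y)" for x y
    using assms by (rule positive_definite_selfadjoint)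
  note lin = linear_matrix_vector_mult_complex[of A]
  have fin: "finite (real_eigenvalues A)"
    unfolding real_eigenvalues_eq by (rule selfadjoint_finite_eigenvalues) (rule sa)
  have quot: "(A *v v) \<bullet> v = l * (v \<bullet> v)" if "A *v v = l *\<^sub>R v" for l v
    by (simp add: that)
  obtain u z where u: "z \<noteq> 0" "A *v z = u *\<^sub>R z" "\<And>x. (A *v x) \<bullet> x \<le> u * (x \<bullet> x)"
    by (rule selfadjoint_greatest_eigenvalue[OF lin sa]) (rule that)
  obtain l y where l: "y \<noteq> 0" "A *v y = l *\<^sub>R y" "\<And>x. l * (x \<bullet> x) \<le> (A *v x) \<bullet> x"
    by (rule selfadjoint_least_eigenvalue[OF lin sa]) (rule that)
  have max: "lambda_max A = u"
    unfolding lambda_max_def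
  proof (rule Max_eqI[OF fin])
    fix k assume "k \<in> real_eigenvalues A"
    then obtain v where v: "v \<noteq> 0" "A *v v = k *\<^sub>R v" by (auto simp: real_eigenvalues_eq)
    then have "k * (v \<bullet> v) \<le> u * (v \<bullet> v)" using u(3)[of v] quot by simp
    then show "k \<le> u" using v by simp
  qed (use u in \<open>auto simp: real_eigenvalues_eq\<close>)
  have min: "lambda_min A = l"
    unfolding lambda_min_def
  proof (rule Min_eqI[OF fin])
    fix k assume "k \<in> real_eigenvalues A"
    then obtain v where v: "v \<noteq> 0" "A *v v = k *\<^sub>R v" by (auto simp: real_eigenvalues_eq)
    then have "l * (v \<bullet> v) \<le> k * (v \<bullet> v)" using l(3)[of v] quot by simp
    then show "l \<le> k" using v by simp
  qed (use l in \<open>auto simp: real_eigenvalues_eq\<close>)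
  have "0 < (A *v y) \<bullet> y"
    using assms l(1) unfolding positive_definite_def Re_cinner_vec by (elim conjE allE impE)
  then have "l * (y \<bullet> y) \<le> u * (y \<bullet> y)" "0 < l * (y \<bullet> y)"
    using u(3)[of y] quot[OF l(2)] by simp_all
  moreover have "0 < y \<bullet> y" using l(1) by simp
  ultimately have "l \<le> u" "0 < l" by (simp_all add: zero_less_mult_iff)
  then show "0 < lambda_min A" "lambda_min A \<le> lambda_max A"
    "lambda_min A * (v \<bullet> v) \<le> (A *v v) \<bullet> v" "(A *v v) \<bullet> v \<le> lambda_max A * (v \<bullet> v)"
    using u(3) l(3) by (simp_all add: max min)
qed

lemma matrix_scaled_minus_mat1_mult:
  fixes A :: "complex^'m^'m"
  shows "(c *\<^sub>R A - mat 1) *v v = c *\<^sub>R (A *v v) - v"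
proof -
  have "(c *\<^sub>R A) *v v = c *\<^sub>R (A *v v)"
    by (simp add: vec_eq_iff matrix_vector_mult_def scaleR_sum_right)
  then show ?thesis
    by (simp add: matrix_vector_mult_diff_rdistrib)
qed

lemma bounded_linear_matrix_vector_mult_complex:
  "bounded_linear (\<lambda>v. A *v v)" for A :: "complex^'m^'m"
  using linear_matrix_vector_mult_complex by (simp add: linear_conv_bounded_linear)

lemma spectral_norm_nonneg: "0 \<le> spectral_norm A"
  unfolding spectral_norm_def by (rule onorm_pos_le[OF bounded_linear_matrix_vector_mult_complex])

text \<open>The witness is $c = 2/(\lambda_{\max}+\lambda_{\min})$.\<close>

lemma eps_star_le_kappa:
  fixes A :: "complex^'m^'m"
  assumes pd: "positive_definite A"
  shows "eps_star A \<le> (kappa A - 1) / (kappa A + 1)"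
proof -
  define l u where "l = lambda_min A" and "u = lambda_max A"
  note lam = positive_definite_lambda[OF pd, folded l_def u_def]
  define c where "c = 2 / (u + l)"
  define r where "r = (u - l) / (u + l)"
  have c: "c > 0" "c * u = 1 + r" "c * l = 1 - r"
    using lam(1,2) by (auto simp: c_def r_def field_simps)
  let ?T = "\<lambda>v. (c *\<^sub>R A - mat 1) *v v"
  have sa: "(A *v x) \<bullet> y = x \<bullet> (A *v y)" for x y
    using pd by (rule positive_definite_selfadjoint)
  have "norm (?T v) \<le> r * norm v" for v
  proof (rule selfadjoint_norm_le)
    show "linear ?T" by (rule linear_matrix_vector_mult_complex)
    show "?T x \<bullet> y = x \<bullet> ?T y" for x y
      by (simp add: matrix_scaled_minus_mat1_mult inner_diff_left inner_diff_right sa)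
    show "\<bar>?T x \<bullet> x\<bar> \<le> r * (x \<bullet> x)" for x
    proof -
      have "c * (l * (x \<bullet> x)) \<le> c * ((A *v x) \<bullet> x)" "c * ((A *v x) \<bullet> x) \<le> c * (u * (x \<bullet> x))"
        using lam(3,4)[of x] c(1) by (auto intro!: mult_left_mono)
      then have "(1 - r) * (x \<bullet> x) \<le> c * ((A *v x) \<bullet> x)"
        "c * ((A *v x) \<bullet> x) \<le> (1 + r) * (x \<bullet> x)"
        unfolding c(2,3)[symmetric] by (simp_all add: mult.assoc)
      then show ?thesis
        unfolding matrix_scaled_minus_mat1_mult inner_diff_left inner_scaleR_left
          by (simp add: abs_le_iff algebra_simps)
    qed
  qed
  then have "spectral_norm (c *\<^sub>R A - mat 1) \<le> r"
    unfolding spectral_norm_def by (rule onorm_le)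
  moreover have "eps_star A \<le> spectral_norm (c *\<^sub>R A - mat 1)"
    unfolding eps_star_def using c(1)
    by (intro cINF_lower) (auto intro!: bdd_belowI2[of _ 0] spectral_norm_nonneg)
  moreover have "r = (kappa A - 1) / (kappa A + 1)"
  proof -
    have "kappa A - 1 = (u - l) / l" "kappa A + 1 = (u + l) / l"
      using lam(1) by (simp_all add: kappa_def diff_divide_distrib add_divide_distrib flip: l_def u_def)
    then show ?thesis using lam(1) by (simp add: r_def)
  qed
  ultimately show ?thesis by simp
qed

section \<open>The Frobenius lower bound\<close>

text \<open>Squared Frobenius norm.\<close>

definition frobenius_sq :: "complex^'m^'m \<Rightarrow> real" where
  "frobenius_sq A = (\<Sum>j\<in>UNIV. \<Sum>k\<in>UNIV. (cmod (A $ j $ k))\<^sup>2)"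

lemma frobenius_sq_le_spectral_norm:
  fixes A :: "complex^'m^'m"
  shows "frobenius_sq A \<le> real CARD('m) * (spectral_norm A)\<^sup>2"
proof -
  have col: "A *v axis k 1 = column k A" for k
    by (simp add: vec_eq_iff matrix_vector_mult_def axis_def column_def if_distrib cong: if_cong)
  have "(\<Sum>j\<in>UNIV. (cmod (A $ j $ k))\<^sup>2) \<le> (spectral_norm A)\<^sup>2" for k
  proof -
    have "norm (A *v axis k 1) \<le> spectral_norm A * norm (axis k (1::complex) :: complex^'m)"
      unfolding spectral_norm_def by (rule onorm[OF bounded_linear_matrix_vector_mult_complex])
    then have "norm (column k A) \<le> spectral_norm A"
      by (simp add: col norm_axis_1)
    then have "(norm (column k A))\<^sup>2 \<le> (spectral_norm A)\<^sup>2" by (simp add: power_mono)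
    moreover have "(norm (column k A))\<^sup>2 = (\<Sum>j\<in>UNIV. (cmod (A $ j $ k))\<^sup>2)"
      by (simp add: norm_vec_def L2_set_def column_def sum_nonneg)
    ultimately show ?thesis by simp
  qed
  then have "(\<Sum>k\<in>UNIV. \<Sum>j\<in>UNIV. (cmod (A $ j $ k))\<^sup>2) \<le> (\<Sum>k\<in>(UNIV::'m set). (spectral_norm A)\<^sup>2)"
    by (intro sum_mono)
  then show ?thesis unfolding frobenius_sq_def by (subst sum.swap) simp
qed

lemma frobenius_sq_scaled_minus_mat1:
  fixes A :: "complex^'m^'m"
  shows "frobenius_sq (c *\<^sub>R A - mat 1)
    = c\<^sup>2 * frobenius_sq A - 2 * c * (\<Sum>j\<in>UNIV. Re (A $ j $ j)) + real CARD('m)"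
proof -
  have "(cmod ((c *\<^sub>R A - mat 1) $ j $ k))\<^sup>2
      = c\<^sup>2 * (cmod (A $ j $ k))\<^sup>2 + (if j = k then 1 - 2 * c * Re (A $ j $ k) else 0)" for j k
    by (simp add: mat_def cmod_power2) (simp add: power2_eq_square algebra_simps)
  then show ?thesis
    by (simp add: frobenius_sq_def sum.distrib sum_distrib_left sum_subtractf)
qed

text \<open>
  Minimizing the quadratic polynomial $c^2\|A\|_F^2 - 2c\,\mathrm{tr}A + m$ over $c$ bounds
  $\varepsilon_\star$ from below.
\<close>

lemma eps_star_ge:
  fixes A :: "complex^'m^'m"
  assumes T: "T = (\<Sum>j\<in>UNIV. Re (A $ j $ j))" "T > 0"
    and le: "T\<^sup>2 \<le> real CARD('m) * (1 - \<rho>) * frobenius_sq A" and "0 \<le> \<rho>"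
  shows "\<rho> \<le> (eps_star A)\<^sup>2"
proof -
  let ?m = "real CARD('m)" and ?F = "frobenius_sq A"
  have F: "?F > 0"
  proof -
    have "?F \<ge> 0" by (simp add: frobenius_sq_def sum_nonneg)
    moreover have "?F \<noteq> 0" using T(2) le by auto
    ultimately show ?thesis by simp
  qed
  have "sqrt \<rho> \<le> eps_star A"
    unfolding eps_star_def
  proof (rule cINF_greatest)
    fix c :: real
    have "?F * (?m * \<rho>) \<le> ?F * (c\<^sup>2 * ?F - 2 * c * T + ?m)"
      using le zero_le_power2[of "c * ?F - T"]
      by (simp add: power2_eq_square algebra_simps)
    then have "?m * \<rho> \<le> c\<^sup>2 * ?F - 2 * c * T + ?m" using F by simp
    also have "\<dots> \<le> ?m * (spectral_norm (c *\<^sub>R A - mat 1))\<^sup>2"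
      using frobenius_sq_le_spectral_norm[of "c *\<^sub>R A - mat 1"]
      by (simp add: frobenius_sq_scaled_minus_mat1 T(1))
    finally have "\<rho> \<le> (spectral_norm (c *\<^sub>R A - mat 1))\<^sup>2" by simp
    then show "sqrt \<rho> \<le> spectral_norm (c *\<^sub>R A - mat 1)"
      by (rule real_le_lsqrt[OF spectral_norm_nonneg])
  qed auto
  then have "(sqrt \<rho>)\<^sup>2 \<le> (eps_star A)\<^sup>2" using \<open>0 \<le> \<rho>\<close> by (intro power_mono) auto
  then show ?thesis using \<open>0 \<le> \<rho>\<close> by simp
qed

section \<open>The iteration count\<close>

text \<open>
  Since $2q(M) \ge \varepsilon_\star(M)$, the hypothesis on $\tau$ gives $q(M)^2 \ge \tau$.
\<close>

lemma n_iter_ge: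
  fixes A :: "complex^'m^'m" and \<delta> \<tau> :: real
  assumes pd: "positive_definite A" and eps: "4 * \<tau> \<le> (eps_star A)\<^sup>2"
    and \<tau>: "0 < \<tau>" "\<tau> < 1" and \<delta>: "0 < \<delta>" "\<delta> < 1"
  shows "\<lceil>2 * ln (\<delta> / 2) / ln \<tau>\<rceil> \<le> int (n_iter A \<delta>)"
proof -
  note lam = positive_definite_lambda[OF pd]
  define s where "s = sqrt (kappa A)"
  define q where "q = q_rate A"
  have k1: "kappa A \<ge> 1" using lam(1,2) by (simp add: kappa_def)
  have s1: "s \<ge> 1" using k1 by (simp add: s_def)
  have ks: "kappa A = s\<^sup>2" using k1 by (simp add: s_def)
  have q_def': "q = (s - 1) / (s + 1)" by (simp add: q_def q_rate_def s_def)
  have q: "0 \<le> q" "q < 1" using s1 by (auto simp: q_def' field_simps)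
  have "0 \<le> eps_star A"
    unfolding eps_star_def by (rule cINF_greatest) (auto intro: spectral_norm_nonneg)
  \<comment> \<open>With \<open>s = sqrt \<kappa>\<close>, the left-hand side equals \<open>2 q / (1 + q\<^sup>2)\<close>.\<close>
  moreover have "(s\<^sup>2 - 1) / (s\<^sup>2 + 1) \<le> 2 * q"
  proof -
    have "s\<^sup>2 - 1 = q * (s + 1)\<^sup>2"
    proof -
      have "q * (s + 1) = s - 1" using s1 by (simp add: q_def')
      then have "q * (s + 1)\<^sup>2 = (s - 1) * (s + 1)"
        by (simp add: power2_eq_square flip: mult.assoc)
      then show ?thesis by (simp add: power2_eq_square algebra_simps)
    qed
    also have "\<dots> \<le> q * (2 * (s\<^sup>2 + 1))"
      using q(1) zero_le_power2[of "s - 1"]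
      by (intro mult_left_mono) (auto simp: power2_eq_square algebra_simps)
    finally have "s\<^sup>2 - 1 \<le> 2 * q * (s\<^sup>2 + 1)" by (simp add: mult_ac)
    then show ?thesis by (intro mult_imp_div_pos_le) (simp_all add: add_nonneg_pos)
  qed
  ultimately have "(eps_star A)\<^sup>2 \<le> (2 * q)\<^sup>2"
    using eps_star_le_kappa[OF pd] unfolding ks by (intro power_mono) auto
  then have \<tau>q: "\<tau> \<le> q\<^sup>2" using eps by simp
  then have q0: "q > 0" using \<tau> q by (cases "q = 0") auto
  have "ln \<tau> \<le> ln (q\<^sup>2)"
    using \<tau>q \<tau> q0 by (subst ln_le_cancel_iff) auto
  then have "ln \<tau> \<le> 2 * ln q" using q0 by (simp add: ln_realpow)
  moreover have lnq: "ln \<tau> < 0" using \<tau> by simp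
  obtain i where i: "n_iter A \<delta> = i" by blast
  \<comment> \<open>The least index is attained because \<open>q < 1\<close>.\<close>
  have "2 * q ^ i \<le> \<delta>"
  proof -
    obtain j where "q ^ j < \<delta> / 2" using real_arch_pow_inv[of "\<delta> / 2" q] q \<delta> by auto
    then have "2 * q_rate A ^ j \<le> \<delta>" by (simp add: q_def)
    then show ?thesis unfolding i[symmetric] n_iter_def q_def by (rule LeastI)
  qed
  then have "ln (q ^ i) \<le> ln (\<delta> / 2)" using q0 \<delta> by (subst ln_le_cancel_iff) auto
  then have "real i * (2 * ln q) \<le> 2 * ln (\<delta> / 2)" using q0 by (simp add: ln_realpow)
  ultimately have "real i * ln \<tau> \<le> 2 * ln (\<delta> / 2)"
    by (meson mult_left_mono of_nat_0_le_iff order_trans)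
  then have "2 * ln (\<delta> / 2) / ln \<tau> \<le> real i"
    using lnq by (simp add: neg_divide_le_eq)
  then show ?thesis unfolding i by (simp add: ceiling_le_iff)
qed

section \<open>Reproducing kernels\<close>

text \<open>
  The reproducing kernel of the span of $\eta$; it does not depend on the orthonormal basis,
  see \<open>reproducing_kernel_unique\<close> below.
\<close>

definition reproducing_kernel :: "('m::finite \<Rightarrow> 'x \<Rightarrow> complex) \<Rightarrow> 'x \<Rightarrow> 'x \<Rightarrow> complex" where
  "reproducing_kernel \<eta> x y = (\<Sum>j\<in>UNIV. \<eta> j x * cnj (\<eta> j y))"

text \<open>
  The function $k$ represents evaluation at $y$; expanding it in the basis $\eta$ yields the
  coefficients $\overline{\eta_j(y)}$.
\<close>

lemma reproducing_kernel_unique: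
  assumes onb: "orthonormal_basis K \<Omega> F \<eta>" and kF: "k \<in> F"
    and rep: "\<And>f. f \<in> F \<Longrightarrow> f y = (\<Sum>x\<in>\<Omega>. f x * cnj (k x))" and x: "x \<in> \<Omega>"
  shows "reproducing_kernel \<eta> x y = k x"
proof -
  have etaF: "\<eta> j \<in> F" and orth: "(\<Sum>x\<in>\<Omega>. \<eta> j x * cnj (\<eta> l x)) = (if j = l then 1 else 0)" for j l
    using onb by (auto simp: orthonormal_basis_def)
  obtain c where k: "k = (\<lambda>x\<in>\<Omega>. \<Sum>j\<in>UNIV. c j * \<eta> j x)"
    using onb kF by (auto simp: orthonormal_basis_def)
  have "c l = cnj (\<eta> l y)" for l
  proof -
    have "cnj (\<eta> l y) = (\<Sum>x\<in>\<Omega>. k x * cnj (\<eta> l x))"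
      by (subst rep[OF etaF]) (simp add: mult.commute)
    also have "\<dots> = (\<Sum>x\<in>\<Omega>. \<Sum>j\<in>UNIV. c j * (\<eta> j x * cnj (\<eta> l x)))"
      by (simp add: k sum_distrib_right mult.assoc)
    also have "\<dots> = (\<Sum>j\<in>UNIV. c j * (\<Sum>x\<in>\<Omega>. \<eta> j x * cnj (\<eta> l x)))"
      by (subst sum.swap) (simp add: sum_distrib_left)
    also have "\<dots> = c l" by (simp add: orth if_distrib cong: if_cong)
    finally show ?thesis by simp
  qed
  then show ?thesis using x by (simp add: k reproducing_kernel_def mult.commute)
qed

lemma normal_matrix_nth:
  "normal_matrix \<eta> n x w $ j $ k
    = (\<Sum>i=1..n. complex_of_real (w i) * (cnj (\<eta> j (x i)) * \<eta> k (x i)))"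
  by (simp add: normal_matrix_def eta_vec_def) (simp add: scaleR_conv_of_real)

lemma trace_normal_matrix:
  "(\<Sum>j\<in>UNIV. Re (normal_matrix \<eta> n x w $ j $ j))
    = (\<Sum>i=1..n. w i * Re (reproducing_kernel \<eta> (x i) (x i)))"
proof -
  have "(\<Sum>j\<in>UNIV. normal_matrix \<eta> n x w $ j $ j)
      = (\<Sum>i=1..n. complex_of_real (w i) * reproducing_kernel \<eta> (x i) (x i))"
    unfolding normal_matrix_nth reproducing_kernel_def
    by (subst sum.swap) (simp add: sum_distrib_left mult_ac)
  from arg_cong[OF this, of Re] show ?thesis by (simp add: Re_sum)
qed

lemma sum_rotate3:
  "(\<Sum>a\<in>A. \<Sum>b\<in>B. \<Sum>c\<in>C. f a b c) = (\<Sum>b\<in>B. \<Sum>c\<in>C. \<Sum>a\<in>A. f a b c)"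
  by (subst sum.swap) (rule sum.cong[OF refl], rule sum.swap)

lemma frobenius_sq_normal_matrix:
  fixes \<eta> :: "'m::finite \<Rightarrow> 'x \<Rightarrow> complex"
  shows "frobenius_sq (normal_matrix \<eta> n x w)
    = (\<Sum>i=1..n. \<Sum>i'=1..n. w i * w i' * (cmod (reproducing_kernel \<eta> (x i) (x i')))\<^sup>2)"
proof -
  let ?M = "normal_matrix \<eta> n x w" and ?K = "reproducing_kernel \<eta>"
  let ?w = "\<lambda>i. complex_of_real (w i)"
  let ?f = "\<lambda>i i' j. \<eta> j (x i) * cnj (\<eta> j (x i'))"
  have MM: "?M $ j $ k * cnj (?M $ j $ k)
      = (\<Sum>i=1..n. \<Sum>i'=1..n. ?w i * ?w i' * ?f i' i j * ?f i i' k)" for j k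
    unfolding normal_matrix_nth cnj_sum sum_product
    by (intro sum.cong refl) (simp add: mult_ac)
  have "complex_of_real (frobenius_sq ?M) = (\<Sum>j\<in>UNIV. \<Sum>k\<in>UNIV. ?M $ j $ k * cnj (?M $ j $ k))"
    by (simp add: frobenius_sq_def complex_norm_square[symmetric])
  also have "\<dots> = (\<Sum>i=1..n. \<Sum>i'=1..n. \<Sum>j\<in>UNIV. \<Sum>k\<in>UNIV. ?w i * ?w i' * ?f i' i j * ?f i i' k)"
    unfolding MM by (simp only: sum_rotate3[where A = "UNIV :: 'm set" and B = "{1..n}" and C = "{1..n}"])
  also have "\<dots> = (\<Sum>i=1..n. \<Sum>i'=1..n. ?w i * ?w i' * (?K (x i') (x i) * ?K (x i) (x i')))"
    unfolding reproducing_kernel_def sum_product by (simp add: sum_distrib_left mult.assoc)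
  also have "\<dots> = (\<Sum>i=1..n. \<Sum>i'=1..n. ?w i * ?w i' * complex_of_real ((cmod (?K (x i) (x i')))\<^sup>2))"
  proof -
    have "?K (x i') (x i) * ?K (x i) (x i') = complex_of_real ((cmod (?K (x i) (x i')))\<^sup>2)" for i i'
      unfolding complex_norm_square by (simp add: reproducing_kernel_def mult.commute)
    then show ?thesis by (simp only:)
  qed
  also have "\<dots> = complex_of_real (\<Sum>i=1..n. \<Sum>i'=1..n. w i * w i' * (cmod (?K (x i) (x i')))\<^sup>2)"
    by simp
  finally show ?thesis by (simp only: of_real_eq_iff)
qed


section \<open>The ETF space\<close>

lemma cinner_vec_self: "cinner_vec a a = complex_of_real ((norm a)\<^sup>2)"
proof -
  have "cinner_vec a a = (\<Sum>j\<in>UNIV. complex_of_real ((cmod (a $ j))\<^sup>2))"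
    by (simp add: cinner_vec_def complex_norm_square del: of_real_power)
  then show ?thesis by (simp add: norm_vec_def L2_set_def sum_nonneg)
qed

lemma cinner_vec_add: "cinner_vec (a + b) c = cinner_vec a c + cinner_vec b c"
  by (simp add: cinner_vec_def algebra_simps sum.distrib)

lemma cinner_vec_scale_left: "cinner_vec (z *s a) b = z * cinner_vec a b"
  by (simp add: cinner_vec_def sum_distrib_left mult.assoc)

lemma cinner_vec_scale_right: "cinner_vec a (z *s b) = cnj z * cinner_vec a b"
  by (simp add: cinner_vec_def sum_distrib_left mult_ac)

lemma tight_frame_polarization:
  fixes \<phi> :: "nat \<Rightarrow> complex^'m"
  assumes tight: "\<And>a. (\<Sum>i\<in>I. (cmod (cinner_vec a (\<phi> i)))\<^sup>2) = C * (norm a)\<^sup>2"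
  shows "(\<Sum>i\<in>I. cinner_vec a (\<phi> i) * cnj (cinner_vec b (\<phi> i))) = C * cinner_vec a b"
proof -
  have re: "Re (\<Sum>i\<in>I. cinner_vec a (\<phi> i) * cnj (cinner_vec b (\<phi> i))) = C * Re (cinner_vec a b)" for a b
  proof -
    have "(cmod (z + w))\<^sup>2 = (cmod z)\<^sup>2 + (cmod w)\<^sup>2 + 2 * Re (z * cnj w)" for z w
      by (simp add: cmod_power2) (simp add: power2_eq_square algebra_simps)
    then have "(\<Sum>i\<in>I. (cmod (cinner_vec (a + b) (\<phi> i)))\<^sup>2)
        = C * (norm a)\<^sup>2 + C * (norm b)\<^sup>2 + 2 * (\<Sum>i\<in>I. Re (cinner_vec a (\<phi> i) * cnj (cinner_vec b (\<phi> i))))"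
      by (simp only: cinner_vec_add sum.distrib sum_distrib_left[symmetric] tight)
    moreover have "(\<Sum>i\<in>I. (cmod (cinner_vec (a + b) (\<phi> i)))\<^sup>2)
        = C * ((norm a)\<^sup>2 + (norm b)\<^sup>2 + 2 * (a \<bullet> b))"
      unfolding tight
      by (simp add: power2_norm_eq_inner inner_add_left inner_add_right inner_commute)
    ultimately show ?thesis by (simp add: Re_cinner_vec algebra_simps)
  qed
  \<comment> \<open>The imaginary parts are the real parts for \<open>a\<close> and \<open>\<i> b\<close>.\<close>
  have "Im (\<Sum>i\<in>I. cinner_vec a (\<phi> i) * cnj (cinner_vec b (\<phi> i))) = C * Im (cinner_vec a b)"
    using re[of a "\<i> *s b"]
    by (simp add: cinner_vec_scale_left cinner_vec_scale_right algebra_simps)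
  with re[of a b] show ?thesis by (simp add: complex_eq_iff)
qed

text \<open>
  Evaluation at $y$ is represented by $f_a$ with $a = \sqrt{m/N}\,\varphi_y$.
\<close>

lemma etf_reproducing_kernel:
  fixes \<phi> :: "nat \<Rightarrow> complex^'m" and \<eta> :: "'k::finite \<Rightarrow> nat \<Rightarrow> complex"
  assumes etf: "equiangular_tight_frame N \<phi>"
    and onb: "orthonormal_basis UNIV {1..N} (etf_space N \<phi>) \<eta>"
    and xy: "x \<in> {1..N}" "y \<in> {1..N}"
  shows "reproducing_kernel \<eta> x y
    = complex_of_real (real CARD('m) / real N) * cinner_vec (\<phi> y) (\<phi> x)"
proof -
  define s where "s = sqrt (real CARD('m) / real N)"
  have N: "N > 0" using xy by auto
  have s2: "complex_of_real s * complex_of_real s = complex_of_real (real CARD('m) / real N)"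
    by (simp add: s_def flip: of_real_mult)
  let ?f = "\<lambda>a. \<lambda>i\<in>{1..N}. complex_of_real s * cinner_vec a (\<phi> i)"
  have sp: "etf_space N \<phi> = range ?f"
    unfolding etf_space_def s_def by auto
  have "reproducing_kernel \<eta> x y = ?f (complex_of_real s *s \<phi> y) x"
  proof (rule reproducing_kernel_unique[OF onb])
    show "?f (complex_of_real s *s \<phi> y) \<in> etf_space N \<phi>" unfolding sp by blast
    fix f assume "f \<in> etf_space N \<phi>"
    then obtain a where f: "f = ?f a" unfolding sp by blast
    have "(\<Sum>i\<in>{1..N}. f i * cnj (?f (complex_of_real s *s \<phi> y) i))
        = complex_of_real s * (complex_of_real s * complex_of_real s)
          * (\<Sum>i=1..N. cinner_vec a (\<phi> i) * cnj (cinner_vec (\<phi> y) (\<phi> i)))"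
      by (simp add: f cinner_vec_scale_left sum_distrib_left mult_ac)
    also have "\<dots> = complex_of_real s * cinner_vec a (\<phi> y)"
      unfolding s2 using etf N
      by (subst tight_frame_polarization[where C = "real N / real CARD('m)"])
         (auto simp: equiangular_tight_frame_def)
    finally show "f y = (\<Sum>i\<in>{1..N}. f i * cnj (?f (complex_of_real s *s \<phi> y) i))"
      using xy by (simp add: f)
  qed (use xy in auto)
  then show ?thesis using xy by (simp add: cinner_vec_scale_left s2 flip: mult.assoc)
qed

text \<open>The coherence of an equiangular tight frame attains the Welch bound.\<close>

lemma etf_coherence:
  fixes \<phi> :: "nat \<Rightarrow> complex^'m"
  assumes etf: "equiangular_tight_frame N \<phi>" and N: "N \<ge> 2"
    and ij: "i \<in> {1..N}" "j \<in> {1..N}" "i \<noteq> j"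
  shows "(cmod (cinner_vec (\<phi> i) (\<phi> j)))\<^sup>2
    = (real N - real CARD('m)) / (real CARD('m) * (real N - 1))"
proof -
  obtain \<mu> where \<mu>: "\<And>i j. i \<in> {1..N} \<Longrightarrow> j \<in> {1..N} \<Longrightarrow> i \<noteq> j \<Longrightarrow> cmod (cinner_vec (\<phi> i) (\<phi> j)) = \<mu>"
    using etf by (auto simp: equiangular_tight_frame_def)
  have unit: "norm (\<phi> i) = 1" and
    tight: "(\<Sum>k=1..N. (cmod (cinner_vec (\<phi> i) (\<phi> k)))\<^sup>2) = real N / real CARD('m) * (norm (\<phi> i))\<^sup>2"
    using etf ij by (auto simp: equiangular_tight_frame_def)
  have "real N / real CARD('m) = (\<Sum>k\<in>{1..N}. (cmod (cinner_vec (\<phi> i) (\<phi> k)))\<^sup>2)"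
    using tight unit by simp
  also have "\<dots> = 1 + (\<Sum>k\<in>{1..N} - {i}. (cmod (cinner_vec (\<phi> i) (\<phi> k)))\<^sup>2)"
    by (subst sum.remove[of _ i]) (use ij unit in \<open>auto simp: cinner_vec_self\<close>)
  also have "(\<Sum>k\<in>{1..N} - {i}. (cmod (cinner_vec (\<phi> i) (\<phi> k)))\<^sup>2) = (\<Sum>k\<in>{1..N} - {i}. \<mu>\<^sup>2)"
    using ij by (intro sum.cong) (auto simp: \<mu>)
  also have "\<dots> = (real N - 1) * \<mu>\<^sup>2"
    using ij N by (simp add: of_nat_diff)
  finally have "real N / real CARD('m) = 1 + (real N - 1) * \<mu>\<^sup>2" .
  then have "(real N - 1) * \<mu>\<^sup>2 = (real N - real CARD('m)) / real CARD('m)"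
    by (simp add: diff_divide_distrib)
  then have "\<mu>\<^sup>2 = (real N - real CARD('m)) / real CARD('m) / (real N - 1)"
    using N by (simp add: eq_divide_eq mult.commute mult.left_commute)
  then show ?thesis using \<mu>[OF ij] by simp
qed

section \<open>The graph space\<close>

lemma finite_edges: "finite V \<Longrightarrow> finite (edges V)"
  by (rule finite_subset[of _ "Pow V"]) (auto simp: edges_def)

lemma edge_ends:
  assumes "edge_ordering V src tgt" "e \<in> edges V"
  shows "e = {src e, tgt e}" "src e \<noteq> tgt e" "src e \<in> V" "tgt e \<in> V"
proof -
  show e: "e = {src e, tgt e}" using assms by (auto simp: edge_ordering_def)
  have "card {src e, tgt e} = 2" "{src e, tgt e} \<subseteq> V"
    using assms(2) unfolding edges_def by (simp_all flip: e)
  then show "src e \<noteq> tgt e" "src e \<in> V" "tgt e \<in> V" by auto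
qed

text \<open>Every edge is counted by two ordered pairs of distinct vertices.\<close>

lemma sum_edges_symmetric:
  fixes h :: "'v \<Rightarrow> 'v \<Rightarrow> real"
  assumes V: "finite V" and ord: "edge_ordering V src tgt"
    and sym: "\<And>u v. h u v = h v u" and diag: "\<And>u. h u u = 0"
  shows "2 * (\<Sum>e\<in>edges V. h (src e) (tgt e)) = (\<Sum>u\<in>V. \<Sum>v\<in>V. h u v)"
proof -
  let ?P = "{p \<in> V \<times> V. fst p \<noteq> snd p}"
  let ?g = "\<lambda>p. {fst p, snd p}"
  have fib: "(\<Sum>p\<in>{p. p \<in> ?P \<and> ?g p = e}. h (fst p) (snd p)) = 2 * h (src e) (tgt e)"
    if e: "e \<in> edges V" for e
  proof -
    note ends = edge_ends[OF ord e]
    have "{p. p \<in> ?P \<and> ?g p = e} = {(src e, tgt e), (tgt e, src e)}"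
      by (subst ends(1)) (use ends(2-4) in \<open>auto simp: doubleton_eq_iff\<close>)
    then show ?thesis using ends(2) sym[of "src e" "tgt e"] by simp
  qed
  have "2 * (\<Sum>e\<in>edges V. h (src e) (tgt e))
      = (\<Sum>e\<in>edges V. \<Sum>p\<in>{p. p \<in> ?P \<and> ?g p = e}. h (fst p) (snd p))"
    unfolding sum_distrib_left by (intro sum.cong refl fib[symmetric])
  also have "\<dots> = (\<Sum>p\<in>?P. h (fst p) (snd p))"
    using V finite_edges[OF V] by (intro sum.group) (auto simp: edges_def)
  also have "\<dots> = (\<Sum>p\<in>V \<times> V. h (fst p) (snd p))"
    using V by (intro sum.mono_neutral_left) (auto simp: diag)
  also have "\<dots> = (\<Sum>u\<in>V. \<Sum>v\<in>V. h u v)"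
    by (simp add: sum.cartesian_product case_prod_unfold)
  finally show ?thesis .
qed

text \<open>
  The Laplacian of the complete graph acts as $|V|$ on vectors with zero sum.
\<close>

lemma sum_edges_differences:
  fixes a b :: "'v \<Rightarrow> real"
  assumes V: "finite V" and ord: "edge_ordering V src tgt" and a0: "(\<Sum>u\<in>V. a u) = 0"
  shows "(\<Sum>e\<in>edges V. (a (src e) - a (tgt e)) * (b (src e) - b (tgt e)))
    = real (card V) * (\<Sum>u\<in>V. a u * b u)"
proof -
  have "2 * (\<Sum>e\<in>edges V. (a (src e) - a (tgt e)) * (b (src e) - b (tgt e)))
      = (\<Sum>u\<in>V. \<Sum>v\<in>V. (a u - a v) * (b u - b v))"
    by (rule sum_edges_symmetric[OF V ord]) (auto simp: algebra_simps)
  also have "\<dots> = (\<Sum>u\<in>V. \<Sum>v\<in>V. a u * b u - a u * b v - b u * a v + a v * b v)"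
    by (intro sum.cong refl) (simp add: algebra_simps)
  also have "\<dots> = (\<Sum>u\<in>V. real (card V) * (a u * b u) - a u * (\<Sum>v\<in>V. b v) - b u * (\<Sum>v\<in>V. a v)
      + (\<Sum>v\<in>V. a v * b v))"
    by (simp add: sum.distrib sum_subtractf sum_distrib_left)
  also have "\<dots> = 2 * (real (card V) * (\<Sum>u\<in>V. a u * b u))"
    by (simp add: sum.distrib sum_subtractf a0 flip: sum_distrib_left sum_distrib_right)
  finally show ?thesis by simp
qed

text \<open>The signed incidence vector of an edge.\<close>

definition incidence :: "('e \<Rightarrow> 'v) \<Rightarrow> ('e \<Rightarrow> 'v) \<Rightarrow> 'e \<Rightarrow> 'v \<Rightarrow> real" where
  "incidence src tgt e u = of_bool (u = src e) - of_bool (u = tgt e)"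

text \<open>
  Evaluation at the edge $f$ is represented by the function of its incidence vector, divided by
  $\sqrt{|V|}$.
\<close>

lemma graph_reproducing_kernel:
  fixes \<eta> :: "'m::finite \<Rightarrow> 'v set \<Rightarrow> complex"
  assumes V: "finite V" and ord: "edge_ordering V src tgt"
    and onb: "orthonormal_basis \<real> (edges V) (graph_space V src tgt) \<eta>"
    and ef: "e \<in> edges V" "f \<in> edges V"
  shows "reproducing_kernel \<eta> e f = complex_of_real
    ((incidence src tgt f (src e) - incidence src tgt f (tgt e)) / real (card V))"
proof -
  define s where "s = sqrt (real (card V))"
  have s: "s > 0" "s * s = real (card V)" "card V > 0"
    using V ef edge_ends(3)[OF ord ef(1)] by (auto simp: s_def card_gt_0_iff)
  let ?f = "\<lambda>a. \<lambda>e\<in>edges V. complex_of_real ((a (src e) - a (tgt e)) / s)"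
  have sp: "graph_space V src tgt = ?f ` {a. (\<Sum>u\<in>V. a u) = 0}"
    unfolding graph_space_def s_def by auto
  note ends = edge_ends[OF ord ef(2)]
  define b where "b u = incidence src tgt f u / s" for u
  have inc: "(\<Sum>u\<in>V. a u * incidence src tgt f u) = a (src f) - a (tgt f)" for a
    using ends V by (simp add: incidence_def right_diff_distrib sum_subtractf of_bool_def
        if_distrib[of "(*) _"] sum.delta' cong: if_cong)
  have "reproducing_kernel \<eta> e f = ?f b e"
  proof (rule reproducing_kernel_unique[OF onb])
    have "(\<Sum>u\<in>V. b u) = 0"
      using inc[of "\<lambda>_. 1"] by (simp add: b_def flip: sum_divide_distrib)
    then show "?f b \<in> graph_space V src tgt" unfolding sp by blast
    fix g assume "g \<in> graph_space V src tgt"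
    then obtain a where g: "g = ?f a" and a0: "(\<Sum>u\<in>V. a u) = 0" unfolding sp by blast
    have "(\<Sum>x\<in>edges V. g x * cnj (?f b x))
        = complex_of_real (\<Sum>x\<in>edges V. (a (src x) - a (tgt x)) * (b (src x) - b (tgt x)) / (s * s))"
      by (simp add: g)
    also have "(\<Sum>x\<in>edges V. (a (src x) - a (tgt x)) * (b (src x) - b (tgt x)) / (s * s))
        = (\<Sum>u\<in>V. a u * b u)"
      unfolding sum_divide_distrib[symmetric] sum_edges_differences[OF V ord a0]
      using s by simp
    also have "\<dots> = (a (src f) - a (tgt f)) / s"
      using inc[of a] by (simp add: b_def flip: sum_divide_distrib)
    finally show "g f = (\<Sum>x\<in>edges V. g x * cnj (?f b x))"
      using ef by (simp add: g)
  qed (use ef in auto)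
  moreover have "(b (src e) - b (tgt e)) / s
      = (incidence src tgt f (src e) - incidence src tgt f (tgt e)) / (s * s)"
    by (simp add: b_def diff_divide_distrib)
  ultimately show ?thesis using ef(1) by (simp only: restrict_apply s(2) if_True)
qed

text \<open>
  The inner product of two incidence vectors is $0$, $\pm 1$ or $\pm 2$ according to the number of
  common vertices.
\<close>

lemma incidence_inner_sq:
  assumes ord: "edge_ordering V src tgt" and ef: "e \<in> edges V" "f \<in> edges V"
  shows "(incidence src tgt f (src e) - incidence src tgt f (tgt e))\<^sup>2
    = real (card (e \<inter> f)) + 2 * of_bool (e = f)"
proof -
  obtain a b c d where *: "src e = a" "tgt e = b" "src f = c" "tgt f = d" by blast
  have e: "e = {a, b}" "a \<noteq> b" and f: "f = {c, d}" "c \<noteq> d"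
    using edge_ends(1,2)[OF ord ef(1)] edge_ends(1,2)[OF ord ef(2)] unfolding * .
  show ?thesis
    unfolding incidence_def * unfolding e(1) f(1) using e(2) f(2)
    by (cases "a = c"; cases "a = d"; cases "b = c"; cases "b = d") (auto simp: doubleton_eq_iff)
qed


section \<open>Lower bounds for the ETF space and the graph space\<close>

text \<open>
  Both spaces lead to a trace inequality with $1-\varrho = (1+\beta)n/(N+\beta n)$, for which
  $\varrho = (N-n)/(N+\beta n)$; moreover $\beta \le 2N/m$, whence $\varrho \ge m/(6n)$.
\<close>

lemma eps_star_and_n_iter_bounds:
  fixes A :: "complex^'m^'m" and N \<beta> :: real
  assumes pd: "positive_definite A"
    and T: "T = (\<Sum>j\<in>UNIV. Re (A $ j $ j))" "T > 0"
    and le: "T\<^sup>2 \<le> real CARD('m) * ((1 + \<beta>) * real n / (N + \<beta> * real n)) * frobenius_sq A"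
    and n: "CARD('m) \<le> n" "real n \<le> N / 2"
    and \<beta>: "0 \<le> \<beta>" "\<beta> * real CARD('m) \<le> 2 * N"
  shows "(N - real n) / (N + \<beta> * real n) \<le> (eps_star A)\<^sup>2"
    and "\<forall>\<delta>::real. 0 < \<delta> \<and> \<delta> < 1 \<longrightarrow>
      \<lceil>2 * ln (\<delta> / 2) / ln (real CARD('m) / (24 * real n))\<rceil> \<le> int (n_iter A \<delta>)"
proof -
  let ?m = "real CARD('m)"
  have m: "0 < ?m" by simp
  have n0: "0 < real n" "?m \<le> real n" using n m by linarith+
  have N0: "0 < N" using n n0 by linarith
  have D: "0 < N + \<beta> * real n" using N0 n0 \<beta> by (simp add: add_pos_nonneg)
  have 1: "1 - (N - real n) / (N + \<beta> * real n) = (1 + \<beta>) * real n / (N + \<beta> * real n)"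
    using D by (simp add: field_simps)
  show eps: "(N - real n) / (N + \<beta> * real n) \<le> (eps_star A)\<^sup>2"
    by (rule eps_star_ge[OF T]) (use le D n n0 in \<open>simp_all add: 1\<close>)
  have "?m / (6 * real n) \<le> (N - real n) / (N + \<beta> * real n)"
  proof -
    have "?m * N \<le> real n * N" using n0 N0 by simp
    moreover have "\<beta> * ?m * real n \<le> 2 * N * real n"
      using \<beta>(2) n0 by (intro mult_right_mono) auto
    ultimately have "?m * (N + \<beta> * real n) \<le> 3 * N * real n" by (simp add: algebra_simps)
    also have "\<dots> \<le> (N - real n) * (6 * real n)"
      using mult_right_mono[of "3 * N" "(N - real n) * 6" "real n"] n n0 by (simp add: mult_ac)
    finally show ?thesis
      using D n0 by (simp add: divide_le_eq le_divide_eq mult_ac)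
  qed
  then have \<tau>: "4 * (?m / (24 * real n)) \<le> (eps_star A)\<^sup>2" using eps by simp
  have "0 < ?m / (24 * real n)"
    by (rule divide_pos_pos[OF m]) (use n0(1) in simp)
  moreover have "?m / (24 * real n) < 1"
    using n0 m by (simp add: divide_less_eq)
  ultimately show "\<forall>\<delta>::real. 0 < \<delta> \<and> \<delta> < 1 \<longrightarrow>
      \<lceil>2 * ln (\<delta> / 2) / ln (real CARD('m) / (24 * real n))\<rceil> \<le> int (n_iter A \<delta>)"
    using n_iter_ge[OF pd \<tau>] by blast
qed

text \<open>
  With $a = m/N$, the squared coherence $t$, the total weight $W$ and $S = \sum_i w_i^2$, the trace
  is $aW$ and $\|M\|_F^2 = a^2(tW^2 + (1-t)S)$, where $S \ge W^2/n$.
\<close>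

lemma etf_bounds:
  fixes \<phi> :: "nat \<Rightarrow> complex^'m" and \<eta> :: "'m \<Rightarrow> nat \<Rightarrow> complex" and w :: "nat \<Rightarrow> real"
  assumes m: "CARD('m) \<ge> 2" and mn: "CARD('m) \<le> n" and w: "\<And>i. i \<in> {1..n} \<Longrightarrow> 0 < w i"
    and etf: "equiangular_tight_frame N \<phi>"
    and onb: "orthonormal_basis UNIV {1..N} (etf_space N \<phi>) \<eta>"
    and nN: "real n \<le> real N / 2" and inj: "inj_on x {1..n}" and xN: "x ` {1..n} \<subseteq> {1..N}"
    and M: "M = normal_matrix \<eta> n x w" and pd: "positive_definite M"
  defines "\<beta> \<equiv> (real N - real CARD('m)) / (real CARD('m) - 1)"
  shows "(real N - real n) / (real N + \<beta> * real n) \<le> (eps_star M)\<^sup>2"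
    and "\<forall>\<delta>::real. 0 < \<delta> \<and> \<delta> < 1 \<longrightarrow>
      \<lceil>2 * ln (\<delta> / 2) / ln (real CARD('m) / (24 * real n))\<rceil> \<le> int (n_iter M \<delta>)"
proof -
  let ?m = "real CARD('m)" and ?I = "{1..n}"
  define W S where "W = (\<Sum>i\<in>?I. w i)" and "S = (\<Sum>i\<in>?I. (w i)\<^sup>2)"
  define a where "a = ?m / real N"
  define t where "t = (real N - ?m) / (?m * (real N - 1))"
  have m2: "?m \<ge> 2" "?m \<le> real n" "real n > 0" using m mn by linarith+
  have N: "real N \<ge> 2 * real n" "N \<ge> 2" using nN m2 by linarith+
  have a: "a > 0" using m2 N by (simp add: a_def)
  have xi: "x i \<in> {1..N}" if "i \<in> ?I" for i using xN that by blast
  have K: "(cmod (reproducing_kernel \<eta> (x i) (x j)))\<^sup>2 = a\<^sup>2 * (if i = j then 1 else t)"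
    if ij: "i \<in> ?I" "j \<in> ?I" for i j
  proof (cases "i = j")
    case True
    have "norm (\<phi> (x j)) = 1" using etf xi[OF ij(2)] by (simp add: equiangular_tight_frame_def)
    then show ?thesis
      unfolding etf_reproducing_kernel[OF etf onb xi[OF ij(1)] xi[OF ij(2)]] a_def
      using True by (simp add: cinner_vec_self norm_mult norm_divide power_divide)
  next
    case False
    then have "x j \<noteq> x i" using inj ij by (auto dest: inj_onD)
    then show ?thesis
      unfolding etf_reproducing_kernel[OF etf onb xi[OF ij(1)] xi[OF ij(2)]] norm_mult power_mult_distrib
      using False etf_coherence[OF etf N(2) xi[OF ij(2)] xi[OF ij(1)]]
      by (simp add: a_def t_def norm_divide)
  qed
  have "(\<Sum>j\<in>UNIV. Re (M $ j $ j)) = (\<Sum>i\<in>?I. w i * a)"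
    unfolding M trace_normal_matrix
  proof (intro sum.cong refl)
    fix i assume i: "i \<in> ?I"
    have "norm (\<phi> (x i)) = 1" using etf xi[OF i] by (simp add: equiangular_tight_frame_def)
    then show "w i * Re (reproducing_kernel \<eta> (x i) (x i)) = w i * a"
      unfolding etf_reproducing_kernel[OF etf onb xi[OF i] xi[OF i]]
      by (simp add: cinner_vec_self a_def)
  qed
  then have T: "a * W = (\<Sum>j\<in>UNIV. Re (M $ j $ j))"
    by (simp add: W_def sum_distrib_left mult.commute)
  have W: "W > 0" unfolding W_def using w m2 by (intro sum_pos) auto
  have T0: "a * W > 0" using a W by simp
  have "frobenius_sq M = (\<Sum>i\<in>?I. \<Sum>j\<in>?I. w i * w j * (a\<^sup>2 * (if i = j then 1 else t)))"
    unfolding M frobenius_sq_normal_matrix by (intro sum.cong refl) (simp only: K)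
  also have "\<dots> = (\<Sum>i\<in>?I. \<Sum>j\<in>?I. a\<^sup>2 * t * (w i * w j) + (if i = j then a\<^sup>2 * (1 - t) * (w i)\<^sup>2 else 0))"
    by (intro sum.cong refl) (auto simp: power2_eq_square algebra_simps)
  also have "\<dots> = a\<^sup>2 * t * (\<Sum>i\<in>?I. \<Sum>j\<in>?I. w i * w j) + a\<^sup>2 * (1 - t) * S"
    by (simp add: sum.distrib S_def flip: sum_distrib_left)
  also have "(\<Sum>i\<in>?I. \<Sum>j\<in>?I. w i * w j) = W\<^sup>2"
    by (simp add: W_def power2_eq_square sum_product)
  finally have F: "frobenius_sq M = a\<^sup>2 * (t * W\<^sup>2 + (1 - t) * S)"
    by (simp add: algebra_simps)
  have "W\<^sup>2 \<le> S * real n"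
    using sum_squared_le_sum_of_squares[of w ?I] by (simp add: W_def S_def)
  then have S: "W\<^sup>2 / real n \<le> S" using m2 by (simp add: divide_le_eq)
  have m1: "0 < ?m - 1" "0 < real N - 1" using m2 N by linarith+
  have mt: "?m * t = (real N - ?m) / (real N - 1)" using m2 by (simp add: t_def)
  have mt': "?m * (1 - t) = real N * (?m - 1) / (real N - 1)"
    using m1 unfolding right_diff_distrib mt by (simp add: field_simps)
  have D: "0 < real N * (?m - 1) + (real N - ?m) * real n"
    using m1 m2 N by (intro add_pos_nonneg mult_pos_pos mult_nonneg_nonneg) linarith+
  have \<beta>1: "(1 + \<beta>) * real n / (real N + \<beta> * real n)
      = (real N - 1) * real n / (real N * (?m - 1) + (real N - ?m) * real n)"
  proof -
    have "1 + \<beta> = (real N - 1) / (?m - 1)"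
      "real N + \<beta> * real n = (real N * (?m - 1) + (real N - ?m) * real n) / (?m - 1)"
      using m1 by (simp_all add: \<beta>_def field_simps)
    then show ?thesis using m1 by simp
  qed
  have "t \<le> 1"
  proof -
    have "?m * t \<le> ?m * 1" unfolding mt using m1 m2 N
      by (simp add: divide_le_eq right_diff_distrib)
    then show ?thesis using m2 by simp
  qed
  then have "a\<^sup>2 * (t * W\<^sup>2 + (1 - t) * (W\<^sup>2 / real n)) \<le> frobenius_sq M"
    unfolding F using S by (intro mult_left_mono add_left_mono) auto
  moreover have "?m * ((1 + \<beta>) * real n / (real N + \<beta> * real n))
      * (a\<^sup>2 * (t * W\<^sup>2 + (1 - t) * (W\<^sup>2 / real n))) = (a * W)\<^sup>2"
  proof -
    have "?m * (t * W\<^sup>2 + (1 - t) * (W\<^sup>2 / real n)) = (?m * t + ?m * (1 - t) / real n) * W\<^sup>2"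
      by (simp add: algebra_simps)
    also have "?m * t + ?m * (1 - t) / real n
        = (real N * (?m - 1) + (real N - ?m) * real n) / ((real N - 1) * real n)"
      unfolding mt mt' using m1 m2 by (simp add: add_divide_distrib add.commute)
    finally have "?m * (t * W\<^sup>2 + (1 - t) * (W\<^sup>2 / real n))
      = (real N * (?m - 1) + (real N - ?m) * real n) / ((real N - 1) * real n) * W\<^sup>2" .
    moreover have "?m * ((1 + \<beta>) * real n / (real N + \<beta> * real n))
      * (a\<^sup>2 * (t * W\<^sup>2 + (1 - t) * (W\<^sup>2 / real n)))
      = (1 + \<beta>) * real n / (real N + \<beta> * real n) * a\<^sup>2 * (?m * (t * W\<^sup>2 + (1 - t) * (W\<^sup>2 / real n)))"
      by (simp only: mult_ac)
    ultimately show ?thesis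
      unfolding \<beta>1 using m1 m2 D by (simp add: power_mult_distrib)
  qed
  moreover have b0: "0 \<le> \<beta>" using m1 m2 N by (simp add: \<beta>_def)
  then have "0 \<le> ?m * ((1 + \<beta>) * real n / (real N + \<beta> * real n))"
    by simp
  ultimately have le: "(a * W)\<^sup>2 \<le> ?m * ((1 + \<beta>) * real n / (real N + \<beta> * real n)) * frobenius_sq M"
    by (metis mult_left_mono)
  have b1: "\<beta> * ?m \<le> 2 * real N"
  proof -
    have "(real N - ?m) * ?m \<le> real N * (2 * (?m - 1))"
      by (intro mult_mono) (use m2 N in simp_all)
    then show ?thesis using m1 by (simp add: \<beta>_def divide_le_eq mult_ac)
  qed
  show "(real N - real n) / (real N + \<beta> * real n) \<le> (eps_star M)\<^sup>2"
    and "\<forall>\<delta>::real. 0 < \<delta> \<and> \<delta> < 1 \<longrightarrow>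
      \<lceil>2 * ln (\<delta> / 2) / ln (real CARD('m) / (24 * real n))\<rceil> \<le> int (n_iter M \<delta>)"
    by (fact eps_star_and_n_iter_bounds[OF pd T T0 le mn nN b0 b1])+
qed

text \<open>
  Here $|V|^2\|M\|_F^2 = 2\sum_i w_i^2 + \sum_v d_v^2$ with the weighted vertex degrees
  $d_v$, whose sum is twice the total weight.
\<close>

lemma graph_bounds:
  fixes \<eta> :: "'m::finite \<Rightarrow> 'v set \<Rightarrow> complex" and w :: "nat \<Rightarrow> real"
  assumes m: "CARD('m) \<ge> 2" and mn: "CARD('m) \<le> n" and w: "\<And>i. i \<in> {1..n} \<Longrightarrow> 0 < w i"
    and V: "finite V" "card V = CARD('m) + 1"
    and N: "N = real CARD('m) * (real CARD('m) + 1) / 2"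
    and ord: "edge_ordering V src tgt"
    and onb: "orthonormal_basis \<real> (edges V) (graph_space V src tgt) \<eta>"
    and nN: "real n \<le> N / 2" and inj: "inj_on x {1..n}" and xE: "x ` {1..n} \<subseteq> edges V"
    and M: "M = normal_matrix \<eta> n x w" and pd: "positive_definite M"
  shows "(N - real n) / (N + real CARD('m) * real n) \<le> (eps_star M)\<^sup>2"
    and "\<forall>\<delta>::real. 0 < \<delta> \<and> \<delta> < 1 \<longrightarrow>
      \<lceil>2 * ln (\<delta> / 2) / ln (real CARD('m) / (24 * real n))\<rceil> \<le> int (n_iter M \<delta>)"
proof -
  let ?m = "real CARD('m)" and ?I = "{1..n}" and ?v = "real (card V)"
  define W S where "W = (\<Sum>i\<in>?I. w i)" and "S = (\<Sum>i\<in>?I. (w i)\<^sup>2)"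
  define d where "d v = (\<Sum>i\<in>?I. w i * of_bool (v \<in> x i))" for v
  have m2: "?m \<ge> 2" "?m \<le> real n" "real n > 0" using m mn by linarith+
  have v: "?v = ?m + 1" "?v > 0" using V(2) by simp_all
  have xi: "x i \<in> edges V" if "i \<in> ?I" for i using xE that by blast
  have card_xi: "card (x i) = 2" if "i \<in> ?I" for i using xi[OF that] by (simp add: edges_def)
  note K = graph_reproducing_kernel[OF V(1) ord onb xi xi]
  have K2: "(cmod (reproducing_kernel \<eta> (x i) (x j)))\<^sup>2
      = (real (card (x i \<inter> x j)) + 2 * of_bool (i = j)) / ?v\<^sup>2" if ij: "i \<in> ?I" "j \<in> ?I" for i j
  proof -
    have "x i = x j \<longleftrightarrow> i = j" using inj ij by (rule inj_on_eq_iff)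
    then show ?thesis
      unfolding K[OF ij] norm_of_real power2_abs power_divide
      incidence_inner_sq[OF ord xi[OF ij(1)] xi[OF ij(2)]] by simp
  qed
  have "(\<Sum>j\<in>UNIV. Re (M $ j $ j)) = (\<Sum>i\<in>?I. w i * (2 / ?v))"
    unfolding M trace_normal_matrix
  proof (intro sum.cong refl)
    fix i assume i: "i \<in> ?I"
    have "src (x i) \<noteq> tgt (x i)" "tgt (x i) \<noteq> src (x i)"
      using edge_ends(2)[OF ord xi[OF i]] by (assumption, rule not_sym)
    then show "w i * Re (reproducing_kernel \<eta> (x i) (x i)) = w i * (2 / ?v)"
      unfolding K[OF i i] by (simp add: incidence_def)
  qed
  then have T: "2 / ?v * W = (\<Sum>j\<in>UNIV. Re (M $ j $ j))"
    unfolding W_def sum_distrib_left by (simp add: mult.commute)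
  have W: "W > 0" unfolding W_def using w m2 by (intro sum_pos) auto
  have T0: "2 / ?v * W > 0" using W v by simp
  have of_bool_card: "real (card (x i \<inter> B)) = (\<Sum>v\<in>V. of_bool (v \<in> x i) * of_bool (v \<in> B))"
    if "i \<in> ?I" for i B
  proof -
    have "V \<inter> {v. v \<in> x i \<and> v \<in> B} = x i \<inter> B" using xi[OF that] by (auto simp: edges_def)
    then show ?thesis using V(1) by (simp flip: of_bool_conj)
  qed
  have degree_sum: "(\<Sum>v\<in>V. d v) = 2 * W"
  proof -
    have "(\<Sum>v\<in>V. d v) = (\<Sum>i\<in>?I. w i * (\<Sum>v\<in>V. of_bool (v \<in> x i) * of_bool (v \<in> UNIV)))"
      unfolding d_def by (subst sum.swap) (simp add: sum_distrib_left)
    also have "\<dots> = (\<Sum>i\<in>?I. w i * 2)"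
      by (intro sum.cong refl) (simp only: of_bool_card[symmetric], simp add: card_xi)
    finally show ?thesis by (simp add: W_def sum_distrib_left mult.commute)
  qed
  have degree_sq: "(\<Sum>i\<in>?I. \<Sum>j\<in>?I. w i * w j * real (card (x i \<inter> x j))) = (\<Sum>v\<in>V. (d v)\<^sup>2)"
  proof -
    have "(\<Sum>v\<in>V. (d v)\<^sup>2)
        = (\<Sum>v\<in>V. \<Sum>i\<in>?I. \<Sum>j\<in>?I. w i * w j * (of_bool (v \<in> x i) * of_bool (v \<in> x j)))"
      unfolding d_def power2_eq_square sum_product by (simp add: mult_ac)
    also have "\<dots> = (\<Sum>i\<in>?I. \<Sum>j\<in>?I. \<Sum>v\<in>V. w i * w j * (of_bool (v \<in> x i) * of_bool (v \<in> x j)))"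
      by (rule sum_rotate3)
    also have "\<dots> = (\<Sum>i\<in>?I. \<Sum>j\<in>?I. w i * w j * real (card (x i \<inter> x j)))"
      by (intro sum.cong refl) (simp only: of_bool_card sum_distrib_left)
    finally show ?thesis ..
  qed
  have "frobenius_sq M
      = (\<Sum>i\<in>?I. \<Sum>j\<in>?I. w i * w j * ((real (card (x i \<inter> x j)) + 2 * of_bool (i = j)) / ?v\<^sup>2))"
    unfolding M frobenius_sq_normal_matrix by (intro sum.cong refl) (simp only: K2)
  also have "\<dots> = (\<Sum>i\<in>?I. \<Sum>j\<in>?I. w i * w j * real (card (x i \<inter> x j))
      + (if i = j then 2 * (w i)\<^sup>2 else 0)) / ?v\<^sup>2"
    unfolding sum_divide_distrib
    by (intro sum.cong refl) (auto simp: power2_eq_square distrib_left)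
  also have "\<dots> = ((\<Sum>v\<in>V. (d v)\<^sup>2) + 2 * S) / ?v\<^sup>2"
    by (simp add: sum.distrib S_def sum_distrib_left flip: degree_sq)
  finally have F: "frobenius_sq M = ((\<Sum>v\<in>V. (d v)\<^sup>2) + 2 * S) / ?v\<^sup>2" .
  have "W\<^sup>2 \<le> S * real n"
    using sum_squared_le_sum_of_squares[of w ?I] by (simp add: W_def S_def)
  then have S: "W\<^sup>2 / real n \<le> S" using m2 by (simp add: divide_le_eq)
  have "(2 * W)\<^sup>2 \<le> (\<Sum>v\<in>V. (d v)\<^sup>2) * ?v"
    using sum_squared_le_sum_of_squares[of d V] by (simp add: degree_sum)
  then have "4 * W\<^sup>2 / ?v \<le> (\<Sum>v\<in>V. (d v)\<^sup>2)" using v by (simp add: divide_le_eq power_mult_distrib)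
  then have "(4 * W\<^sup>2 / ?v + 2 * (W\<^sup>2 / real n)) / ?v\<^sup>2 \<le> frobenius_sq M"
    unfolding F using S by (intro divide_right_mono add_mono) auto
  moreover have "?m * ((1 + ?m) * real n / (N + ?m * real n))
      * ((4 * W\<^sup>2 / ?v + 2 * (W\<^sup>2 / real n)) / ?v\<^sup>2) = (2 / ?v * W)\<^sup>2"
  proof -
    have D: "N + ?m * real n = ?m * (?v + 2 * real n) / 2"
      unfolding N v(1) by (simp add: field_simps)
    have "?m * ((1 + ?m) * real n / (N + ?m * real n)) = 2 * ?v * real n / (?v + 2 * real n)"
      unfolding D using m2 v by (simp add: add.commute)
    moreover have "4 * W\<^sup>2 / ?v + 2 * (W\<^sup>2 / real n) = 2 * W\<^sup>2 * (?v + 2 * real n) / (?v * real n)"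
      using v(2) m2(3) by (simp add: divide_simps) (simp add: algebra_simps)
    moreover have "?v + 2 * real n > 0" using v(2) m2(3) by linarith
    ultimately show ?thesis using v(2) m2(3) by (simp add: power_mult_distrib power_divide)
  qed
  moreover have "0 \<le> N" unfolding N by simp
  then have "0 \<le> ?m * ((1 + ?m) * real n / (N + ?m * real n))" by simp
  ultimately have le: "(2 / ?v * W)\<^sup>2 \<le> ?m * ((1 + ?m) * real n / (N + ?m * real n)) * frobenius_sq M"
    by (metis mult_left_mono)
  have b: "0 \<le> ?m" "?m * ?m \<le> 2 * N" unfolding N by (simp_all add: algebra_simps)
  show "(N - real n) / (N + ?m * real n) \<le> (eps_star M)\<^sup>2"
    and "\<forall>\<delta>::real. 0 < \<delta> \<and> \<delta> < 1 \<longrightarrow>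
      \<lceil>2 * ln (\<delta> / 2) / ln (real CARD('m) / (24 * real n))\<rceil> \<le> int (n_iter M \<delta>)"
    by (fact eps_star_and_n_iter_bounds[OF pd T T0 le mn nN b])+
qed

theorem proposition5p1:
  fixes n :: nat and w :: "nat \<Rightarrow> real"
  assumes "CARD('m::finite) \<ge> 2"
    and "CARD('m) \<le> n"
    and "\<forall>i\<in>{1..n}. 0 < w i"
  shows
    "(\<forall>(N :: nat) (\<phi> :: nat \<Rightarrow> complex^'m) (\<eta> :: 'm \<Rightarrow> nat \<Rightarrow> complex) (x :: nat \<Rightarrow> nat) M.
        equiangular_tight_frame N \<phi> \<longrightarrow>
        orthonormal_basis UNIV {1..N} (etf_space N \<phi>) \<eta> \<longrightarrow>
        real n \<le> real N / 2 \<longrightarrow>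
        inj_on x {1..n} \<longrightarrow> x ` {1..n} \<subseteq> {1..N} \<longrightarrow>
        M = normal_matrix \<eta> n x w \<longrightarrow> positive_definite M \<longrightarrow>
          (eps_star M)\<^sup>2 \<ge> (real N - real n)
             / (real N + (real N - real CARD('m)) / (real CARD('m) - 1) * real n) \<and>
          (\<forall>\<delta>::real. 0 < \<delta> \<and> \<delta> < 1 \<longrightarrow>
             int (n_iter M \<delta>) \<ge> \<lceil>2 * ln (\<delta> / 2) / ln (real CARD('m) / (24 * real n))\<rceil>))
     \<and>
     (\<forall>(N :: nat) (V :: 'v set) (src :: 'v set \<Rightarrow> 'v) (tgt :: 'v set \<Rightarrow> 'v)
        (\<eta> :: 'm \<Rightarrow> 'v set \<Rightarrow> complex) (x :: nat \<Rightarrow> 'v set) M.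
        finite V \<longrightarrow> card V = CARD('m) + 1 \<longrightarrow>
        real N = real CARD('m) * (real CARD('m) + 1) / 2 \<longrightarrow>
        edge_ordering V src tgt \<longrightarrow>
        orthonormal_basis \<real> (edges V) (graph_space V src tgt) \<eta> \<longrightarrow>
        real n \<le> real N / 2 \<longrightarrow>
        inj_on x {1..n} \<longrightarrow> x ` {1..n} \<subseteq> edges V \<longrightarrow>
        M = normal_matrix \<eta> n x w \<longrightarrow> positive_definite M \<longrightarrow>
          (eps_star M)\<^sup>2 \<ge> (real N - real n) / (real N + real CARD('m) * real n) \<and>
          (\<forall>\<delta>::real. 0 < \<delta> \<and> \<delta> < 1 \<longrightarrow>
             int (n_iter M \<delta>) \<ge> \<lceil>2 * ln (\<delta> / 2) / ln (real CARD('m) / (24 * real n))\<rceil>))"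
proof ((rule conjI; intro allI impI), goal_cases)
  case (1 N \<phi> \<eta> x M)
  have w: "0 < w i" if "i \<in> {1..n}" for i using assms(3) that by blast
  show ?case by (rule conjI[OF etf_bounds[OF assms(1,2) w 1]])
next
  case (2 N V src tgt \<eta> x M)
  have w: "0 < w i" if "i \<in> {1..n}" for i using assms(3) that by blast
  show ?case by (rule conjI[OF graph_bounds[OF assms(1,2) w 2]])
qed

end
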